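(* Let $n\ge2$ and $\tau_i=(c_i,d_i,p_i,J_i)$, $i=1,\dots,n$, nonnegative integers with $c_i\ge1$, $p_i\ge1$, $c_i\le d_i\le p_i$, $0\le J_i\le p_i$, $\sum_{i<n}c_i/p_i<1$, and harmonic periods; let $p_{\max}=\max_{i\le n}p_i$. Let $I\subseteq\{1,\dots,n-1\}$ and $\gamma\in\mathbb{Z}_{\ge1}$. Then \[ \mathcal{R}(I,\gamma)=\min\Big\{t\in\mathbb{Z}_{\ge0}: t\ge\gamma+\sum_{i\in I}c_i\Big\lceil\frac{t+J_i}{p_i}\Big\rceil\Big\} \] can be computed using $O(q\cdot|I|^2+|I|^2\log p_{\max})$ arithmetic operations, where $q=|\{p_i-J_i : i\in I\}|$.
   Context: Periods are harmonic if $p_i\ge p_j$ implies $p_i/p_j\in\mathbb{Z}$. Running times count arithmetic operations on numbers from the input. $\mathcal{R}(\{1,\dots,n-1\},c_n)$ is the worst-case response time of $\tau_n$ under fixed-priority scheduling with release jitter. *)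

theory Defs
  imports Complex_Main
begin

section \<open>Tasks with harmonic periods and worst-case response times\<close>

text \<open>Task number \<open>i\<close> is \<open>(c i, d i, p i, J i)\<close> for \<open>i \<in> {1..n}\<close>; values of these functions
  outside \<open>{1..n}\<close> are irrelevant.\<close>

definition harmonic :: "nat \<Rightarrow> (nat \<Rightarrow> nat) \<Rightarrow> bool" where
  "harmonic n p \<longleftrightarrow>
    (\<forall>i\<in>{1..n}. \<forall>j\<in>{1..n}. p i \<ge> p j \<longrightarrow> real (p i) / real (p j) \<in> \<int>)"

definition harmonic_task_system ::
    "nat \<Rightarrow> (nat \<Rightarrow> nat) \<Rightarrow> (nat \<Rightarrow> nat) \<Rightarrow> (nat \<Rightarrow> nat) \<Rightarrow> (nat \<Rightarrow> nat) \<Rightarrow> bool" where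
  "harmonic_task_system n c d p J \<longleftrightarrow>
    n \<ge> 2 \<and>
    (\<forall>i\<in>{1..n}. c i \<ge> 1 \<and> p i \<ge> 1 \<and> c i \<le> d i \<and> d i \<le> p i \<and> J i \<le> p i) \<and>
    (\<Sum>i\<in>{1..<n}. real (c i) / real (p i)) < 1 \<and>
    harmonic n p"

definition response_bound ::
    "(nat \<Rightarrow> nat) \<Rightarrow> (nat \<Rightarrow> nat) \<Rightarrow> (nat \<Rightarrow> nat) \<Rightarrow> nat set \<Rightarrow> nat \<Rightarrow> nat \<Rightarrow> bool" where
  "response_bound c p J I \<gamma> t \<longleftrightarrow>
    int t \<ge> int \<gamma> + (\<Sum>i\<in>I. int (c i) * \<lceil>(real t + real (J i)) / real (p i)\<rceil>)"

definition response_time ::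
    "(nat \<Rightarrow> nat) \<Rightarrow> (nat \<Rightarrow> nat) \<Rightarrow> (nat \<Rightarrow> nat) \<Rightarrow> nat set \<Rightarrow> nat \<Rightarrow> nat" where
  "response_time c p J I \<gamma> = (LEAST t. response_bound c p J I \<gamma> t)"

lemma response_bound_exists:
  assumes sys: "harmonic_task_system n c d p J" and I: "I \<subseteq> {1..n - 1}"
  shows "\<exists>t. response_bound c p J I \<gamma> t"
proof -
  define U where "U = (\<Sum>i\<in>I. real (c i) / real (p i))"
  define K where "K = (\<Sum>i\<in>I. real (c i) * (real (J i) / real (p i) + 1))"
  have "I \<subseteq> {1..<n}" using I by fastforce
  then have "U \<le> (\<Sum>i\<in>{1..<n}. real (c i) / real (p i))"
    unfolding U_def by (intro sum_mono2) auto
  then have U: "U < 1" using sys by (simp add: harmonic_task_system_def)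
  obtain t :: nat where t: "(real \<gamma> + K) / (1 - U) \<le> real t"
    using real_arch_simple by blast
  have "(\<Sum>i\<in>I. real (c i) * real_of_int \<lceil>(real t + real (J i)) / real (p i)\<rceil>)
      \<le> (\<Sum>i\<in>I. real (c i) * ((real t + real (J i)) / real (p i) + 1))"
    by (intro sum_mono mult_left_mono) linarith+
  also have "\<dots> = real t * U + K"
    by (simp add: U_def K_def sum_distrib_left sum.distrib[symmetric] add_divide_distrib algebra_simps)
  also have "\<dots> \<le> real t - real \<gamma>"
    using t U by (simp add: field_simps)
  finally have "real_of_int (int \<gamma> + (\<Sum>i\<in>I. int (c i) * \<lceil>(real t + real (J i)) / real (p i)\<rceil>))
      \<le> real_of_int (int t)"
    by simp
  then have "response_bound c p J I \<gamma> t"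
    unfolding response_bound_def by (simp only: of_int_le_iff)
  then show ?thesis ..
qed


section \<open>Programs and the number of operations they perform\<close>

text \<open>A random access machine on integers, presented as a structured language: finitely many
  registers and finitely many arrays (unbounded, with computed indices) occur in a program.
  The only operations on numbers are the four below; \<open>Quot\<close> is division rounding down.
  An expression used as the test of \<open>If\<close> or \<open>While\<close> counts as true iff its value is positive,
  so comparing two numbers requires a subtraction.\<close>

datatype arith = Add | Sub | Mul | Quot

datatype exp =
    Const int
  | Reg nat
  | Cell nat exp
  | Bin arith exp exp

datatype com =
    Skip
  | Assign nat exp
  | Store nat exp exp
  | Seq com com
  | If exp com com
  | While exp com

type_synonym state = "(nat \<Rightarrow> int) \<times> (nat \<Rightarrow> int \<Rightarrow> int)"

fun arith_val :: "arith \<Rightarrow> int \<Rightarrow> int \<Rightarrow> int" where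
  "arith_val Add x y = x + y"
| "arith_val Sub x y = x - y"
| "arith_val Mul x y = x * y"
| "arith_val Quot x y = x div y"

fun exp_val :: "exp \<Rightarrow> state \<Rightarrow> int" where
  "exp_val (Const z) s = z"
| "exp_val (Reg r) s = fst s r"
| "exp_val (Cell a e) s = snd s a (exp_val e s)"
| "exp_val (Bin f e1 e2) s = arith_val f (exp_val e1 s) (exp_val e2 s)"

fun exp_ops :: "exp \<Rightarrow> nat" where
  "exp_ops (Const z) = 0"
| "exp_ops (Reg r) = 0"
| "exp_ops (Cell a e) = exp_ops e"
| "exp_ops (Bin f e1 e2) = exp_ops e1 + exp_ops e2 + 1"

text \<open>\<open>exec P s k s'\<close>: started in \<open>s\<close>, the program \<open>P\<close> terminates in \<open>s'\<close> at cost \<open>k\<close>. The cost is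
  the number of arithmetic operations performed (including those for array indices, loop
  counters and comparisons) plus the number of loop iterations. Because iterations are charged,
  the total number of elementary steps of any kind is at most a constant, depending only on \<open>P\<close>,
  times \<open>k + 1\<close>; hence no work can be hidden in data movement or control flow.\<close>

inductive exec :: "com \<Rightarrow> state \<Rightarrow> nat \<Rightarrow> state \<Rightarrow> bool" where
  Skip: "exec Skip s 0 s"
| Assign: "exec (Assign r e) s (exp_ops e) ((fst s)(r := exp_val e s), snd s)"
| Store: "exec (Store a i e) s (exp_ops i + exp_ops e)
    (fst s, (snd s)(a := (snd s a)(exp_val i s := exp_val e s)))"
| Seq: "exec P1 s k1 s' \<Longrightarrow> exec P2 s' k2 s'' \<Longrightarrow> exec (Seq P1 P2) s (k1 + k2) s''"
| IfTrue: "exp_val b s > 0 \<Longrightarrow> exec P1 s k s' \<Longrightarrow> exec (If b P1 P2) s (exp_ops b + k) s'"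
| IfFalse: "exp_val b s \<le> 0 \<Longrightarrow> exec P2 s k s' \<Longrightarrow> exec (If b P1 P2) s (exp_ops b + k) s'"
| WhileFalse: "exp_val b s \<le> 0 \<Longrightarrow> exec (While b P) s (exp_ops b) s"
| WhileTrue: "exp_val b s > 0 \<Longrightarrow> exec P s k1 s' \<Longrightarrow> exec (While b P) s' k2 s'' \<Longrightarrow>
    exec (While b P) s (exp_ops b + 1 + k1 + k2) s''"

inductive_cases exec_SkipE: "exec Skip s k s'"
inductive_cases exec_AssignE: "exec (Assign r e) s k s'"
inductive_cases exec_StoreE: "exec (Store a i e) s k s'"
inductive_cases exec_SeqE: "exec (Seq P1 P2) s k s'"
inductive_cases exec_IfE: "exec (If b P1 P2) s k s'"
inductive_cases exec_WhileE: "exec (While b P) s k s'"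

lemma exec_deterministic:
  "exec P s k t \<Longrightarrow> exec P s k' t' \<Longrightarrow> k = k' \<and> t = t'"
proof (induction arbitrary: k' t' rule: exec.induct)
  case (Skip s)
  then show ?case by (rule exec_SkipE) simp
next
  case (Assign r e s)
  then show ?case by (rule exec_AssignE) simp
next
  case (Store a i e s)
  then show ?case by (rule exec_StoreE) simp
next
  case (Seq P1 s k1 s' P2 k2 s'')
  from Seq.prems show ?case by (rule exec_SeqE) (use Seq.IH in blast)
next
  case (IfTrue b s P1 k s' P2)
  from IfTrue.prems show ?case
    by (rule exec_IfE) (use IfTrue.hyps in \<open>auto dest: IfTrue.IH\<close>)
next
  case (IfFalse b s P2 k s' P1)
  from IfFalse.prems show ?case
    by (rule exec_IfE) (use IfFalse.hyps in \<open>auto dest: IfFalse.IH\<close>)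
next
  case (WhileFalse b s P)
  from WhileFalse.prems show ?case
    by (rule exec_WhileE) (use WhileFalse.hyps in simp_all)
next
  case (WhileTrue b s P k1 s' k2 s'')
  from WhileTrue.prems obtain l1 u l2 where k': "k' = exp_ops b + 1 + l1 + l2"
    and runs: "exec P s l1 u" "exec (While b P) u l2 t'"
    by (rule exec_WhileE) (use WhileTrue.hyps in simp_all)
  from WhileTrue.IH(1)[OF runs(1)] have "k1 = l1" "s' = u" by simp_all
  with WhileTrue.IH(2)[of l2 t'] runs(2) k' show ?case by simp
qed

text \<open>Input: registers 0, 1, 2 hold \<open>n\<close>, the length of \<open>xs\<close> and \<open>\<gamma>\<close>; arrays 0 to 3 hold
  \<open>c\<close>, \<open>d\<close>, \<open>p\<close>, \<open>J\<close> at the indices \<open>1..n\<close>; array 4 holds the list \<open>xs\<close> (the elements of \<open>I\<close>)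
  from index 0 on. Everything else is 0.\<close>

definition input_state ::
    "nat \<Rightarrow> (nat \<Rightarrow> nat) \<Rightarrow> (nat \<Rightarrow> nat) \<Rightarrow> (nat \<Rightarrow> nat) \<Rightarrow> (nat \<Rightarrow> nat) \<Rightarrow> nat list \<Rightarrow> nat \<Rightarrow> state"
  where
  "input_state n c d p J xs \<gamma> =
    (\<lambda>r. if r = 0 then int n else if r = 1 then int (length xs) else if r = 2 then int \<gamma> else 0,
     \<lambda>a z. if a < 4 \<and> 1 \<le> z \<and> z \<le> int n then int (([c, d, p, J] ! a) (nat z))
       else if a = 4 \<and> 0 \<le> z \<and> z < int (length xs) then int (xs ! nat z)
       else 0)"

text \<open>Output: the final value of register 0.\<close>

definition computes_at_cost :: "com \<Rightarrow> state \<Rightarrow> int \<Rightarrow> nat \<Rightarrow> bool" where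
  "computes_at_cost P s v k \<longleftrightarrow> (\<exists>s'. exec P s k s' \<and> fst s' 0 = v)"

end

theory Submission
  imports Defs
begin

text \<open>For a set \<open>S\<close> of tasks let the surplus at time \<open>t\<close> be \<open>t\<close> minus the sum over \<open>i \<in> S\<close> of
  \<open>c\<^sub>i \<lceil>(t + J\<^sub>i) / p\<^sub>i\<rceil>\<close>; the response time is the first \<open>t\<close> at which the surplus of \<open>I\<close> reaches \<open>\<gamma>\<close>.
  If all periods in \<open>S\<close> divide \<open>L\<close>, the surplus grows by a fixed positive gain when \<open>t\<close> advances by
  \<open>L\<close>. Adding a task \<open>x\<close> whose period is a multiple of all earlier ones, the maximum of the new
  surplus up to \<open>y\<close> is therefore attained either with the current number of jobs of \<open>x\<close> or with one job
  less, just in the period ending at the last release of \<open>x\<close> before \<open>y\<close>. So these maxima satisfy a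
  two-term recurrence, and only their values at the \<open>|I|\<close> points \<open>- J\<^sub>i\<close> are needed. Going back from the
  largest period to the smallest, the maximum at \<open>- J\<^sub>x\<close> and the gain determine the number \<open>k\<close> of jobs
  of \<open>x\<close> released before the response time, and \<open>x\<close> can be dropped after adding \<open>c\<^sub>x k\<close> to the
  demand. Altogether this takes \<open>O(|I|\<^sup>2)\<close> operations, within the bound since \<open>q \<ge> 1\<close> for
  nonempty \<open>I\<close>.\<close>

section \<open>Preliminaries: a weakest-precondition calculus with costs\<close>

lemma atLeastLessThan_eq_insert: "m < n \<Longrightarrow> {m..<n::nat} = insert m {Suc m..<n}"
  by auto

text \<open>The existential form includes termination, and since execution is deterministic it loses
  nothing. The cost is an argument of the postcondition, so that correctness and running time are
  derived together.\<close>

definition wp :: "com \<Rightarrow> (nat \<Rightarrow> state \<Rightarrow> bool) \<Rightarrow> state \<Rightarrow> bool" where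
  "wp P Q s \<longleftrightarrow> (\<exists>k s'. exec P s k s' \<and> Q k s')"

lemma wp_Skip [simp]: "wp Skip Q s = Q 0 s"
  unfolding wp_def by (blast intro: exec.Skip elim: exec_SkipE)

lemma wp_Assign [simp]: "wp (Assign r e) Q s = Q (exp_ops e) ((fst s)(r := exp_val e s), snd s)"
  unfolding wp_def by (blast intro: exec.Assign elim: exec_AssignE)

lemma wp_Store [simp]: "wp (Store a i e) Q s = Q (exp_ops i + exp_ops e)
    (fst s, (snd s)(a := (snd s a)(exp_val i s := exp_val e s)))"
  unfolding wp_def by (blast intro: exec.Store elim: exec_StoreE)

lemma wp_Seq [simp]: "wp (Seq P1 P2) Q s = wp P1 (\<lambda>k1. wp P2 (\<lambda>k2. Q (k1 + k2))) s"
proof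
  assume "wp (Seq P1 P2) Q s"
  then show "wp P1 (\<lambda>k1. wp P2 (\<lambda>k2. Q (k1 + k2))) s"
    unfolding wp_def by (elim exE conjE exec_SeqE) blast
next
  assume "wp P1 (\<lambda>k1. wp P2 (\<lambda>k2. Q (k1 + k2))) s"
  then show "wp (Seq P1 P2) Q s"
    unfolding wp_def by (blast intro: exec.Seq)
qed

lemma wp_If [simp]: "wp (If b P1 P2) Q s =
    (if exp_val b s > 0 then wp P1 (\<lambda>k. Q (exp_ops b + k)) s else wp P2 (\<lambda>k. Q (exp_ops b + k)) s)"
proof -
  have "wp (If b P1 P2) Q s = wp P1 (\<lambda>k. Q (exp_ops b + k)) s" if "exp_val b s > 0"
    using that unfolding wp_def by (auto elim!: exec_IfE intro: exec.IfTrue)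
  moreover have "wp (If b P1 P2) Q s = wp P2 (\<lambda>k. Q (exp_ops b + k)) s" if "exp_val b s \<le> 0"
    using that unfolding wp_def by (auto elim!: exec_IfE intro: exec.IfFalse)
  ultimately show ?thesis by simp
qed

lemma wp_mono: "wp P Q s \<Longrightarrow> (\<And>k s'. Q k s' \<Longrightarrow> R k s') \<Longrightarrow> wp P R s"
  unfolding wp_def by blast

text \<open>The register read by the test equals the index of the invariant and serves as
  termination measure. A bare register costs no operation to test, so a round costs its body plus 1
  for the iteration, and leaving the loop is free.\<close>

lemma wp_countdown:
  assumes step: "\<And>j s. Inv (Suc j) s \<Longrightarrow> wp P (\<lambda>k s'. k \<le> K \<and> Inv j s') s"
    and reg: "\<And>j s. Inv j s \<Longrightarrow> fst s r = int j"
    and init: "Inv n s"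
  shows "wp (While (Reg r) P) (\<lambda>k s'. k \<le> n * (K + 1) \<and> Inv 0 s') s"
  using init
proof (induction n arbitrary: s)
  case 0
  then have "exec (While (Reg r) P) s 0 s"
    using exec.WhileFalse[of "Reg r" s P] reg[OF 0] by simp
  then show ?case using 0 unfolding wp_def by blast
next
  case (Suc n)
  obtain k s' where k: "exec P s k s'" "k \<le> K" "Inv n s'"
    using step[OF Suc.prems] by (auto simp: wp_def)
  obtain k' s'' where k': "exec (While (Reg r) P) s' k' s''" "k' \<le> n * (K + 1)" "Inv 0 s''"
    using Suc.IH[OF k(3)] by (auto simp: wp_def)
  have "exec (While (Reg r) P) s (1 + k + k') s''"
    using exec.WhileTrue[of "Reg r" s P k s' k' s''] reg[OF Suc.prems] k(1) k'(1) by simp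
  then show ?case
    unfolding wp_def using k(2) k'(2,3) by (intro exI[of _ "1 + k + k'"] exI[of _ s'']) simp
qed

section \<open>The program\<close>

text \<open>Array 5 holds, at index \<open>x\<close>, the current peak at time \<open>- J x\<close> increased by \<open>J x\<close>, so that its
  initial content 0 is correct for the empty set of tasks; array 6 holds the gain of task \<open>x\<close> together
  with all tasks of smaller period, per period of \<open>x\<close>. Register 1 is the boundary in array 4 between
  the tasks still to be added and the added ones, which are sorted by decreasing period; register 2 is the
  demand and register 3 counts the added tasks. Registers 6 and 7 are the current gain and period.
  The loops test registers only, as a run on the empty task set has to be free of charge.\<close>

abbreviation (input) task :: "exp \<Rightarrow> exp" where "task \<equiv> Cell 4"
abbreviation (input) cost_of :: "exp \<Rightarrow> exp" where "cost_of \<equiv> Cell 0"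
abbreviation (input) period_of :: "exp \<Rightarrow> exp" where "period_of \<equiv> Cell 2"
abbreviation (input) jitter_of :: "exp \<Rightarrow> exp" where "jitter_of \<equiv> Cell 3"
abbreviation (input) peak_of :: "exp \<Rightarrow> exp" where "peak_of \<equiv> Cell 5"
abbreviation (input) gain_of :: "exp \<Rightarrow> exp" where "gain_of \<equiv> Cell 6"

definition select_min :: com where
  "select_min = Seq (Assign 4 (Reg 1)) (While (Reg 4)
    (Seq (Assign 4 (Bin Sub (Reg 4) (Const 1)))
      (If (Bin Sub (period_of (task (Reg 1))) (period_of (task (Reg 4))))
        (Seq (Assign 5 (task (Reg 1)))
          (Seq (Store 4 (Reg 1) (task (Reg 4))) (Store 4 (Reg 4) (Reg 5))))
        Skip)))"

text \<open>Register 9 is minus the number of jobs of the newly added task at the point under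
  treatment; registers 10 and 11 are the two candidates of the recurrence, both increased by the
  jitter as array 5 requires.\<close>

definition update_peaks :: com where
  "update_peaks = Seq (Assign 4 (Reg 1)) (While (Reg 4)
    (Seq (Assign 4 (Bin Sub (Reg 4) (Const 1)))
    (Seq (Assign 8 (task (Reg 4)))
    (Seq (Assign 9 (Bin Quot (Bin Sub (jitter_of (Reg 8)) (jitter_of (Reg 5))) (period_of (Reg 5))))
    (Seq (Assign 10 (Bin Add (peak_of (Reg 8)) (Bin Mul (cost_of (Reg 5)) (Reg 9))))
    (Seq (Assign 11 (Bin Sub
            (Bin Add (peak_of (Reg 5)) (Bin Sub (jitter_of (Reg 8)) (jitter_of (Reg 5))))
            (Bin Mul (Bin Add (Reg 9) (Const 1)) (Reg 6))))
      (If (Bin Sub (Reg 11) (Reg 10))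
        (Store 5 (Reg 8) (Reg 11))
        (Store 5 (Reg 8) (Reg 10)))))))))"

text \<open>The gain over the old period is first rescaled to the new one, which is a multiple of
  it; then the one job released per new period is charged.\<close>

definition ascend :: com where
  "ascend =
    Seq (Assign 1 (Bin Sub (Reg 1) (Const 1)))
    (Seq select_min
    (Seq (Assign 5 (task (Reg 1)))
    (Seq (Assign 6 (Bin Sub (Bin Mul (Reg 6) (Bin Quot (period_of (Reg 5)) (Reg 7))) (cost_of (Reg 5))))
    (Seq (Assign 7 (period_of (Reg 5)))
    (Seq (Store 6 (Reg 5) (Reg 6))
    (Seq update_peaks
      (Assign 3 (Bin Add (Reg 3) (Const 1)))))))))"

text \<open>\<open>Quot\<close> rounds down, so the quotient is minus the number \<open>k\<close> of
  jobs; subtracting its product with the cost therefore adds \<open>c k\<close> to the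
  demand.\<close>

definition descend :: com where
  "descend =
    Seq (Assign 5 (task (Reg 1)))
    (Seq (Assign 2 (Bin Sub (Reg 2) (Bin Mul (cost_of (Reg 5))
      (Bin Quot (Bin Sub (Bin Sub (peak_of (Reg 5)) (jitter_of (Reg 5))) (Reg 2)) (gain_of (Reg 5))))))
    (Seq (Assign 1 (Bin Add (Reg 1) (Const 1)))
      (Assign 3 (Bin Sub (Reg 3) (Const 1)))))"

definition response_program :: com where
  "response_program =
    Seq (Assign 6 (Const 1)) (Seq (Assign 7 (Const 1))
    (Seq (While (Reg 1) ascend) (Seq (While (Reg 3) descend) (Assign 0 (Reg 2)))))"

lemma swap_image_eq: "a \<in> A \<Longrightarrow> b \<in> A \<Longrightarrow> (f(a := f b, b := f a)) ` A = f ` A"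
  by (auto simp: image_iff)

section \<open>Job counts, surplus, peaks and first times of harmonic tasks\<close>

locale harmonic_tasks =
  fixes c p J :: "nat \<Rightarrow> nat" and I :: "nat set"
  assumes fin: "finite I"
    and p_pos: "i \<in> I \<Longrightarrow> 0 < p i"
    and p_dvd: "i \<in> I \<Longrightarrow> j \<in> I \<Longrightarrow> p i \<le> p j \<Longrightarrow> p i dvd p j"
    and util: "(\<Sum>i\<in>I. real (c i) / real (p i)) < 1"
begin

text \<open>Rounding up, expressed by \<open>div\<close> on the negated numerator. Time is an
  arbitrary integer because peaks are taken at the points \<open>- J i\<close>.\<close>

definition jobs :: "nat \<Rightarrow> int \<Rightarrow> int" where
  "jobs i t = - ((- (t + int (J i))) div int (p i))"

definition surplus :: "nat set \<Rightarrow> int \<Rightarrow> int" where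
  "surplus S t = t - (\<Sum>i\<in>S. int (c i) * jobs i t)"

definition gain :: "nat set \<Rightarrow> int \<Rightarrow> int" where
  "gain S L = L - (\<Sum>i\<in>S. int (c i) * (L div int (p i)))"

text \<open>A relation instead of a maximum operator: the half-line below \<open>y\<close> is
  infinite, so that the supremum is attained is part of what has to be proved.\<close>

definition peak :: "nat set \<Rightarrow> int \<Rightarrow> int \<Rightarrow> bool" where
  "peak S y v \<longleftrightarrow> (\<exists>t\<le>y. surplus S t = v) \<and> (\<forall>t\<le>y. surplus S t \<le> v)"

definition first_time :: "nat set \<Rightarrow> int \<Rightarrow> int \<Rightarrow> bool" where
  "first_time S a t \<longleftrightarrow> a \<le> surplus S t \<and> (\<forall>t'<t. surplus S t' < a)"

lemma jobs_le_iff: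
  assumes "i \<in> I"
  shows "jobs i t \<le> k \<longleftrightarrow> t + int (J i) \<le> k * int (p i)"
proof -
  have "jobs i t = \<lceil>real_of_int (t + int (J i)) / real_of_int (int (p i))\<rceil>"
    unfolding jobs_def by (rule ceiling_divide_eq_div[symmetric])
  then have "jobs i t \<le> k \<longleftrightarrow> real_of_int (t + int (J i)) \<le> real_of_int (k * int (p i))"
    using p_pos[OF assms] by (simp add: ceiling_le_iff pos_divide_le_eq)
  then show ?thesis
    by (simp only: of_int_le_iff)
qed

lemma jobs_mono: "i \<in> I \<Longrightarrow> s \<le> t \<Longrightarrow> jobs i s \<le> jobs i t"
  using jobs_le_iff[of i s "jobs i t"] jobs_le_iff[of i t "jobs i t"] by simp

lemma jobs_eqI:
  assumes "i \<in> I" "k * int (p i) - int (J i) - int (p i) < t" "t \<le> k * int (p i) - int (J i)"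
  shows "jobs i t = k"
proof -
  have "\<not> jobs i t \<le> k - 1" "jobs i t \<le> k"
    unfolding jobs_le_iff[OF assms(1)] using assms(2,3) by (simp_all add: algebra_simps)
  then show ?thesis by simp
qed

lemma jobs_shift:
  assumes "i \<in> I" "int (p i) dvd L"
  shows "jobs i (t + k * L) = jobs i t + k * (L div int (p i))"
proof -
  obtain q where q: "L = int (p i) * q" using assms(2) by (elim dvdE)
  have "- (t + k * L + int (J i)) = - (t + int (J i)) + (- (k * q)) * int (p i)"
    by (simp add: q algebra_simps)
  then have "(- (t + k * L + int (J i))) div int (p i) = - (k * q) + (- (t + int (J i))) div int (p i)"
    using p_pos[OF assms(1)] by (simp only: div_mult_self1)
  then show ?thesis
    using p_pos[OF assms(1)] by (simp add: jobs_def q)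
qed

lemma surplus_shift:
  assumes "S \<subseteq> I" "\<And>i. i \<in> S \<Longrightarrow> int (p i) dvd L"
  shows "surplus S (t + k * L) = surplus S t + k * gain S L"
proof -
  have "(\<Sum>i\<in>S. int (c i) * jobs i (t + k * L)) =
      (\<Sum>i\<in>S. int (c i) * jobs i t + k * (int (c i) * (L div int (p i))))"
    using assms by (intro sum.cong) (auto simp: jobs_shift subset_iff distrib_left mult.left_commute)
  then show ?thesis
    by (simp add: surplus_def gain_def sum.distrib sum_distrib_left algebra_simps)
qed

lemma surplus_insert:
  assumes "insert x S \<subseteq> I" "x \<notin> S"
  shows "surplus (insert x S) t = surplus S t - int (c x) * jobs x t"
  using assms finite_subset[OF _ fin, of S] by (simp add: surplus_def)

lemma gain_insert:
  assumes "insert x S \<subseteq> I" "x \<notin> S"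
  shows "gain (insert x S) (int (p x)) = gain S (int (p x)) - int (c x)"
  using assms finite_subset[OF _ fin, of S] p_pos[of x] by (simp add: gain_def)

text \<open>Division is exact for every period dividing \<open>L\<close>, so the gain is linear.
  This justifies rescaling the stored gain by a single multiplication.\<close>

lemma gain_mult:
  assumes "\<And>i. i \<in> S \<Longrightarrow> int (p i) dvd L"
  shows "gain S (L * r) = gain S L * r"
proof -
  have "(\<Sum>i\<in>S. int (c i) * (L * r div int (p i))) = (\<Sum>i\<in>S. int (c i) * (L div int (p i)) * r)"
    using assms by (intro sum.cong) (auto simp: div_mult_swap[symmetric] dvd_div_mult mult.assoc)
  then show ?thesis
    by (simp add: gain_def sum_distrib_right left_diff_distrib)
qed

lemma util_subset: "S \<subseteq> I \<Longrightarrow> (\<Sum>i\<in>S. real (c i) / real (p i)) < 1"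
  using util sum_mono2[OF fin, of S "\<lambda>i. real (c i) / real (p i)"] by force

text \<open>The gain equals \<open>L\<close> times one minus the utilization of \<open>S\<close>,
  and that utilization is below 1.\<close>

lemma gain_pos:
  assumes "S \<subseteq> I" "\<And>i. i \<in> S \<Longrightarrow> int (p i) dvd L" "0 < L"
  shows "0 < gain S L"
proof -
  have "real_of_int (\<Sum>i\<in>S. int (c i) * (L div int (p i))) =
      (\<Sum>i\<in>S. real_of_int L * (real (c i) / real (p i)))"
    unfolding of_int_sum using assms(2) by (intro sum.cong) (auto simp: real_of_int_div)
  also have "\<dots> < real_of_int L"
    unfolding sum_distrib_left[symmetric] using util_subset[OF assms(1)] assms(3) by simp
  finally have "(\<Sum>i\<in>S. int (c i) * (L div int (p i))) < L"
    by (simp only: of_int_less_iff)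
  then show ?thesis
    by (simp add: gain_def)
qed

text \<open>Translation by \<open>k * L\<close> maps one half-line onto the other and changes all
  surpluses by the same amount; \<open>k\<close> may be negative.\<close>

lemma peak_shift:
  assumes "S \<subseteq> I" "\<And>i. i \<in> S \<Longrightarrow> int (p i) dvd L" "peak S y v"
  shows "peak S (y + k * L) (v + k * gain S L)"
  unfolding peak_def
proof (intro conjI allI impI)
  obtain t where "t \<le> y" "surplus S t = v"
    using assms(3) by (auto simp: peak_def)
  then have "t + k * L \<le> y + k * L" "surplus S (t + k * L) = v + k * gain S L"
    using surplus_shift[OF assms(1,2)] by simp_all
  then show "\<exists>t\<le>y + k * L. surplus S t = v + k * gain S L" by blast
next
  fix t assume "t \<le> y + k * L"
  then have "surplus S (t + (- k) * L) \<le> v"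
    using assms(3) by (simp add: peak_def)
  then show "surplus S t \<le> v + k * gain S L"
    using surplus_shift[OF assms(1,2), of t "- k"] by simp
qed

lemma peak_empty: "peak {} y y"
  by (auto simp: peak_def surplus_def)

text \<open>The two-term recurrence. Between the last change of the job count of \<open>x\<close>
  and \<open>y\<close> the count is constant, which gives the first candidate. Earlier times can be
  moved into the last full period before that change, where the count is one less; the peak of
  \<open>S\<close> at its end is a translate of \<open>w\<close>.\<close>

lemma peak_insert:
  assumes I: "insert x S \<subseteq> I" and x: "x \<notin> S"
    and dvd: "\<And>i. i \<in> S \<Longrightarrow> int (p i) dvd int (p x)"
    and v: "peak S y v" and w: "peak S (- int (J x)) w"
  defines "D \<equiv> gain (insert x S) (int (p x))"
  shows "peak (insert x S) y (max (v - int (c x) * jobs x y) (w + (jobs x y - 1) * D))"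
proof -
  define N where "N = jobs x y"
  \<comment> \<open>The last time at which \<open>x\<close> has only \<open>N - 1\<close>
    jobs.\<close>
  define s where "s = - int (J x) + (N - 1) * int (p x)"
  have xI: "x \<in> I" and SI: "S \<subseteq> I" using I by auto
  have px: "0 < int (p x)" using p_pos[OF xI] by simp
  have dvd': "\<And>i. i \<in> insert x S \<Longrightarrow> int (p i) dvd int (p x)" using dvd by auto
  have D: "0 < D" unfolding D_def by (rule gain_pos[OF I dvd' px])
  have s: "peak S s (w + (N - 1) * (D + int (c x)))"
    using peak_shift[OF SI dvd w, of "N - 1"] gain_insert[OF I x] by (simp add: s_def D_def)
  have y: "s < y" "y \<le> s + int (p x)"
    using jobs_le_iff[OF xI, of y N] jobs_le_iff[OF xI, of y "N - 1"]
    by (auto simp: N_def s_def algebra_simps)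
  have ins: "surplus (insert x S) t = surplus S t - int (c x) * jobs x t" for t
    by (rule surplus_insert[OF I x])
  have jobs_s: "jobs x s = N - 1"
    using px by (intro jobs_eqI[OF xI]) (auto simp: s_def algebra_simps)
  have upper: "surplus (insert x S) t \<le> max (v - int (c x) * N) (w + (N - 1) * D)" if "t \<le> y" for t
  proof (cases "t \<le> s")
    case False
    then have "jobs x t = N"
      using that y by (intro jobs_eqI[OF xI]) (auto simp: s_def algebra_simps)
    then show ?thesis
      using v that by (auto simp: ins peak_def)
  next
    case True
    \<comment> \<open>Move \<open>t\<close> by whole periods into the last period before \<open>s\<close>: the surplus does not decrease.\<close>
    define l where "l = (s - t) div int (p x)"
    define u where "u = t + l * int (p x)"
    have "u = s - (s - t) mod int (p x)"
      using div_mult_mod_eq[of "s - t" "int (p x)"] unfolding u_def l_def by linarith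
    then have u: "u \<le> s" "s - int (p x) < u"
      using px pos_mod_bound[OF px, of "s - t"] pos_mod_sign[OF px, of "s - t"] by linarith+
    have "0 \<le> l" using True px by (simp add: l_def pos_imp_zdiv_nonneg_iff)
    then have "surplus (insert x S) t \<le> surplus (insert x S) u"
      using D surplus_shift[OF I dvd', of t l] by (simp add: u_def D_def)
    also have "jobs x u = N - 1"
      using u by (intro jobs_eqI[OF xI]) (auto simp: s_def algebra_simps)
    then have "surplus (insert x S) u \<le> w + (N - 1) * D"
      using s u(1) unfolding ins peak_def by (fastforce simp: algebra_simps)
    finally show ?thesis by simp
  qed
  \<comment> \<open>The witness of \<open>v\<close> may lie before \<open>s\<close>, where
    \<open>x\<close> has fewer jobs, so only an inequality is available here; likewise for
    \<open>t2\<close>.\<close>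
  obtain t1 where t1: "t1 \<le> y" "surplus S t1 = v"
    using v by (auto simp: peak_def)
  have "jobs x t1 \<le> N" unfolding N_def using jobs_mono[OF xI] t1 by simp
  then have g1: "v - int (c x) * N \<le> surplus (insert x S) t1"
    using t1 by (simp add: ins mult_left_mono)
  obtain t2 where t2: "t2 \<le> s" "surplus S t2 = w + (N - 1) * (D + int (c x))"
    using s by (auto simp: peak_def)
  have "jobs x t2 \<le> N - 1" using jobs_mono[OF xI t2(1)] jobs_s by simp
  then have "int (c x) * jobs x t2 \<le> int (c x) * (N - 1)" by (simp add: mult_left_mono)
  then have g2: "w + (N - 1) * D \<le> surplus (insert x S) t2"
    using t2 by (simp add: ins algebra_simps)
  \<comment> \<open>At the witness of the larger candidate the surplus is at least that candidate,
    and \<open>upper\<close> forbids more.\<close>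
  have "\<exists>t\<le>y. surplus (insert x S) t = max (v - int (c x) * N) (w + (N - 1) * D)"
  proof (cases "v - int (c x) * N \<le> w + (N - 1) * D")
    case True
    then show ?thesis
      using g2 upper[of t2] t2(1) y(1) by (intro exI[of _ t2]) (simp add: max_def)
  next
    case False
    then show ?thesis
      using g1 upper[of t1] t1(1) by (intro exI[of _ t1]) (simp add: max_def)
  qed
  then show ?thesis
    using upper by (simp add: peak_def N_def)
qed

lemma jobs_0: "jobs x (- int (J x)) = 0"
  by (simp add: jobs_def)

text \<open>At \<open>- J x\<close> the task \<open>x\<close> has no jobs, so the candidates are
  \<open>w\<close> and \<open>w\<close> minus a positive gain.\<close>

lemma peak_insert_self:
  assumes "insert x S \<subseteq> I" "x \<notin> S" "\<And>i. i \<in> S \<Longrightarrow> int (p i) dvd int (p x)"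
    and "peak S (- int (J x)) w"
  shows "peak (insert x S) (- int (J x)) w"
proof -
  have "0 < gain (insert x S) (int (p x))"
    using assms p_pos[of x] by (intro gain_pos) auto
  then show ?thesis
    using peak_insert[OF assms(1-3) assms(4) assms(4)] assms(1)
    by (simp add: jobs_0 max_def)
qed

text \<open>The peaks at \<open>- J x + l * p x\<close> increase by the gain with each
  \<open>l\<close>. The first of them to reach \<open>a\<close> is at \<open>l = k\<close>, so
  \<open>t\<close> lies in the period ending there and \<open>x\<close> has exactly \<open>k\<close>
  jobs at \<open>t\<close>. Earlier times have at most \<open>k\<close> jobs, hence a fixed charge
  \<open>c x * k\<close> can replace \<open>x\<close>.\<close>

lemma first_time_insert:
  assumes I: "insert x S \<subseteq> I" and x: "x \<notin> S"
    and dvd: "\<And>i. i \<in> S \<Longrightarrow> int (p i) dvd int (p x)"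
    and b: "peak (insert x S) (- int (J x)) b"
    and t: "first_time (insert x S) a t"
  defines "k \<equiv> - ((b - a) div gain (insert x S) (int (p x)))"
  shows "first_time S (a + int (c x) * k) t"
proof -
  define D where "D = gain (insert x S) (int (p x))"
  have xI: "x \<in> I" and SI: "S \<subseteq> I" using I by auto
  have dvd': "\<And>i. i \<in> insert x S \<Longrightarrow> int (p i) dvd int (p x)" using dvd by auto
  have D: "0 < D" unfolding D_def using p_pos[OF xI] by (intro gain_pos[OF I dvd']) auto
  have pk: "peak (insert x S) (- int (J x) + l * int (p x)) (b + l * D)" for l
    unfolding D_def by (rule peak_shift[OF I dvd' b])
  \<comment> \<open>\<open>k\<close> is \<open>(a - b) / D\<close> rounded up, read off from
    division with remainder.\<close>
  have "b - a = - k * D + (b - a) mod D"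
    unfolding k_def D_def[symmetric] by simp
  then have k: "a \<le> b + k * D" "b + (k - 1) * D < a"
    using pos_mod_bound[OF D, of "b - a"] pos_mod_sign[OF D, of "b - a"]
    by (auto simp: algebra_simps)
  obtain t1 where "t1 \<le> - int (J x) + k * int (p x)" "surplus (insert x S) t1 = b + k * D"
    using pk[of k] by (auto simp: peak_def)
  moreover have "surplus (insert x S) t1 < a" if "t1 < t"
    using t that by (simp add: first_time_def)
  ultimately have "t \<le> - int (J x) + k * int (p x)"
    using k(1) by linarith
  \<comment> \<open>The peak one period earlier is still below \<open>a\<close>, so \<open>t\<close>
    cannot lie in that half-line.\<close>
  moreover have "surplus (insert x S) t \<le> b + (k - 1) * D" if "t \<le> - int (J x) + (k - 1) * int (p x)"
    using pk[of "k - 1"] that by (simp add: peak_def)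
  then have "- int (J x) + (k - 1) * int (p x) < t"
    using k(2) t unfolding first_time_def by linarith
  ultimately have jt: "jobs x t = k"
    by (intro jobs_eqI[OF xI]) (auto simp: algebra_simps)
  have ins: "surplus (insert x S) t = surplus S t - int (c x) * jobs x t" for t
    by (rule surplus_insert[OF I x])
  show ?thesis
    unfolding first_time_def
  proof (intro conjI allI impI)
    show "a + int (c x) * k \<le> surplus S t"
      using t by (simp add: first_time_def ins jt)
  next
    fix t' assume "t' < t"
    then have "surplus S t' - int (c x) * jobs x t' < a" "int (c x) * jobs x t' \<le> int (c x) * k"
      using t jobs_mono[OF xI, of t' t] by (auto simp: first_time_def ins jt mult_left_mono)
    then show "surplus S t' < a + int (c x) * k" by linarith
  qed
qed

lemma first_time_empty: "first_time {} a t \<Longrightarrow> t = a"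
  by (force simp: first_time_def surplus_def)

text \<open>Each job count is at least \<open>t / p i\<close>, so the surplus is at most
  \<open>t\<close> times one minus the utilization, which is nonpositive here.\<close>

lemma surplus_nonpos:
  assumes "t \<le> 0"
  shows "surplus I t \<le> 0"
proof -
  define U where "U = (\<Sum>i\<in>I. real (c i) / real (p i))"
  have "real_of_int t * (real (c i) / real (p i)) \<le> real_of_int (int (c i) * jobs i t)"
    if "i \<in> I" for i
  proof -
    have "t \<le> jobs i t * int (p i)"
      using jobs_le_iff[OF that, of t "jobs i t"] by simp
    then have "real_of_int t \<le> real_of_int (jobs i t) * real (p i)"
      by (metis of_int_le_iff of_int_mult of_int_of_nat_eq)
    then have "real_of_int t / real (p i) \<le> real_of_int (jobs i t)"
      using p_pos[OF that] by (simp add: divide_le_eq)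
    then have "real (c i) * (real_of_int t / real (p i)) \<le> real (c i) * real_of_int (jobs i t)"
      by (rule mult_left_mono) simp
    then show ?thesis by (simp add: mult.commute)
  qed
  then have "real_of_int t * U \<le> real_of_int (\<Sum>i\<in>I. int (c i) * jobs i t)"
    unfolding U_def of_int_sum sum_distrib_left by (rule sum_mono)
  moreover have "real_of_int t \<le> real_of_int t * U"
    using assms util mult_left_mono_neg[of U 1 "real_of_int t"] by (simp add: U_def)
  ultimately have "real_of_int t \<le> real_of_int (\<Sum>i\<in>I. int (c i) * jobs i t)" by linarith
  then show ?thesis
    by (simp add: surplus_def del: of_int_sum)
qed

lemma response_bound_iff: "response_bound c p J I \<gamma> t \<longleftrightarrow> int \<gamma> \<le> surplus I (int t)"
proof -
  have "\<lceil>(real t + real (J i)) / real (p i)\<rceil> = jobs i (int t)" for i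
    using ceiling_divide_eq_div[of "int t + int (J i)" "int (p i)"]
    by (simp add: jobs_def)
  then show ?thesis
    by (auto simp: response_bound_def surplus_def)
qed

text \<open>The response time is a minimum over naturals, a first time is one over all integers;
  they agree because a negative time has nonpositive surplus and the demand is positive.\<close>

lemma first_time_response:
  assumes "\<exists>t. response_bound c p J I \<gamma> t" "0 < \<gamma>"
  shows "first_time I (int \<gamma>) (int (response_time c p J I \<gamma>))"
  unfolding first_time_def
proof (intro conjI allI impI)
  show "int \<gamma> \<le> surplus I (int (response_time c p J I \<gamma>))"
    using LeastI_ex[OF assms(1)] by (simp add: response_time_def response_bound_iff)
next
  fix t assume "t < int (response_time c p J I \<gamma>)"
  show "surplus I t < int \<gamma>"
  proof (cases "0 \<le> t")
    case True
    then have "nat t < response_time c p J I \<gamma>"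
      using \<open>t < _\<close> by linarith
    then have "\<not> response_bound c p J I \<gamma> (nat t)"
      unfolding response_time_def by (rule not_less_Least)
    then show ?thesis using True by (simp add: response_bound_iff)
  next
    case False
    then show ?thesis using surplus_nonpos[of t] assms(2) by simp
  qed
qed

section \<open>Correctness and cost of the program\<close>

definition holds_params :: "(nat \<Rightarrow> int \<Rightarrow> int) \<Rightarrow> bool" where
  "holds_params h \<longleftrightarrow> (\<forall>x\<in>I. h 0 (int x) = int (c x) \<and> h 2 (int x) = int (p x) \<and> h 3 (int x) = int (J x))"

text \<open>Being onto \<open>I\<close> from \<open>card I\<close> positions forces \<open>y\<close>
  to be injective there, so \<open>y\<close> is the current ordering of the tasks.\<close>

definition lists_tasks :: "(nat \<Rightarrow> nat) \<Rightarrow> (nat \<Rightarrow> int \<Rightarrow> int) \<Rightarrow> bool" where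
  "lists_tasks y h \<longleftrightarrow> y ` {..<card I} = I \<and> (\<forall>i<card I. h 4 (int i) = int (y i))"

lemma lists_tasks_inj: "lists_tasks y h \<Longrightarrow> inj_on y {..<card I}"
  by (intro eq_card_imp_inj_on) (auto simp: lists_tasks_def)

lemma lists_tasks_mem: "lists_tasks y h \<Longrightarrow> i < card I \<Longrightarrow> y i \<in> I"
  by (auto simp: lists_tasks_def)

text \<open>One round of selection sort. The invariant says that position \<open>u\<close> has the
  least period among the positions from \<open>j\<close> to \<open>u\<close>; swaps stay within
  positions up to \<open>u\<close>. The factor 3 is a decrement, a comparison and the
  iteration.\<close>

lemma select_min:
  assumes "fst s 1 = int u" "u < card I" "holds_params (snd s)" "lists_tasks y (snd s)"
  shows "wp select_min (\<lambda>k s'. k \<le> 3 * u \<and>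
      (\<forall>a. a \<noteq> 4 \<longrightarrow> snd s' a = snd s a) \<and> (\<forall>r. r \<noteq> 4 \<and> r \<noteq> 5 \<longrightarrow> fst s' r = fst s r) \<and>
      (\<exists>y'. lists_tasks y' (snd s') \<and> y' ` {..u} = y ` {..u} \<and> (\<forall>i>u. y' i = y i) \<and>
        (\<forall>i\<le>u. p (y' u) \<le> p (y' i)))) s"
proof -
  define Inv where "Inv = (\<lambda>j s'. j \<le> u \<and> fst s' 4 = int j \<and>
      (\<forall>a. a \<noteq> 4 \<longrightarrow> snd s' a = snd s a) \<and> (\<forall>r. r \<noteq> 4 \<and> r \<noteq> 5 \<longrightarrow> fst s' r = fst s r) \<and>
      (\<exists>y'. lists_tasks y' (snd s') \<and> y' ` {..u} = y ` {..u} \<and> (\<forall>i>u. y' i = y i) \<and>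
        (\<forall>i. j \<le> i \<and> i \<le> u \<longrightarrow> p (y' u) \<le> p (y' i))))"
  let ?B = "Seq (Assign 4 (Bin Sub (Reg 4) (Const 1)))
      (If (Bin Sub (period_of (task (Reg 1))) (period_of (task (Reg 4))))
        (Seq (Assign 5 (task (Reg 1)))
          (Seq (Store 4 (Reg 1) (task (Reg 4))) (Store 4 (Reg 4) (Reg 5))))
        Skip)"
  have step: "wp ?B (\<lambda>k s''. k \<le> 2 \<and> Inv j s'') s'" if inv: "Inv (Suc j) s'" for j s'
  proof -
    obtain y' where y': "lists_tasks y' (snd s')" "y' ` {..u} = y ` {..u}" "\<forall>i>u. y' i = y i"
        "\<forall>i. Suc j \<le> i \<and> i \<le> u \<longrightarrow> p (y' u) \<le> p (y' i)"
      using inv by (auto simp: Inv_def)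
    have j: "j < u" "fst s' 4 = 1 + int j" "fst s' 1 = int u"
      and frame: "\<forall>a. a \<noteq> 4 \<longrightarrow> snd s' a = snd s a"
        "\<forall>r. r \<noteq> 4 \<and> r \<noteq> 5 \<longrightarrow> fst s' r = fst s r"
      using inv assms(1) by (auto simp: Inv_def)
    have cells: "snd s' 4 (int u) = int (y' u)" "snd s' 4 (int j) = int (y' j)"
      using y'(1) assms(2) j(1) by (auto simp: lists_tasks_def)
    have per: "snd s' 2 (int (y' i)) = int (p (y' i))" if "i \<le> u" for i
      using frame(1) assms(2,3) lists_tasks_mem[OF y'(1), of i] that by (auto simp: holds_params_def)
    show ?thesis
    proof (cases "p (y' j) < p (y' u)")
      case True
      define y'' where "y'' = y'(u := y' j, j := y' u)"
      have img: "y'' ` {..u} = y ` {..u}" "y'' ` {..<card I} = y' ` {..<card I}"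
        unfolding y''_def y'(2)[symmetric] using j(1) assms(2)
        by (intro swap_image_eq; simp)+
      have tasks: "lists_tasks y'' ((snd s')(4 := (snd s' 4)(int u := int (y' j), int j := int (y' u))))"
        using y'(1) img(2) by (auto simp: lists_tasks_def y''_def)
      have "\<forall>i>u. y'' i = y i" "\<forall>i. j \<le> i \<and> i \<le> u \<longrightarrow> p (y'' u) \<le> p (y'' i)"
        using y'(3,4) j(1) True
        by (auto simp: y''_def Suc_le_eq order.strict_iff_order[of j] intro: less_imp_le less_le_trans)
      then show ?thesis
        using True j frame cells per[of u] per[of j] img(1) tasks
        by (auto simp: Inv_def intro!: exI[of _ y''])
    next
      case False
      have "\<forall>i. j \<le> i \<and> i \<le> u \<longrightarrow> p (y' u) \<le> p (y' i)"
        using y'(4) False by (metis Suc_leI le_neq_implies_less linorder_not_less)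
      then show ?thesis
        using False j frame cells per[of u] per[of j] y'(1-3)
        by (auto simp: Inv_def intro!: exI[of _ y'])
    qed
  qed
  have "Inv u ((fst s)(4 := int u), snd s)"
    using assms by (auto simp: Inv_def intro!: exI[of _ y])
  then have "wp (While (Reg 4) ?B) (\<lambda>k s'. k \<le> u * (2 + 1) \<and> Inv 0 s') ((fst s)(4 := int u), snd s)"
    by (rule wp_countdown[where Inv = Inv, OF step, rotated 2]) (auto simp: Inv_def)
  then show ?thesis
    unfolding select_min_def using assms(1)
    by (auto simp: Inv_def elim!: wp_mono)
qed

text \<open>The update can be done in place: each new peak uses only its own old value and the entry
  of \<open>x\<close>, which the loop never overwrites. A round has 11 operations and one
  iteration.\<close>

lemma update_peaks:
  assumes u: "fst s 1 = int u" "u < card I" and par: "holds_params (snd s)"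
    and y: "lists_tasks y (snd s)"
    and x: "y u = x" "fst s 5 = int x" "fst s 6 = gain (insert x S) (int (p x))"
    and S: "S = y ` {Suc u..<card I}" "\<And>i. i \<in> S \<Longrightarrow> int (p i) dvd int (p x)"
    and pk: "\<And>i. i \<le> u \<Longrightarrow> peak S (- int (J (y i))) (snd s 5 (int (y i)) - int (J (y i)))"
  shows "wp update_peaks (\<lambda>k s'. k \<le> 12 * u \<and>
      (\<forall>a. a \<noteq> 5 \<longrightarrow> snd s' a = snd s a) \<and> (\<forall>r. r < 8 \<and> r \<noteq> 4 \<longrightarrow> fst s' r = fst s r) \<and>
      (\<forall>i. u < i \<and> i < card I \<longrightarrow> snd s' 5 (int (y i)) = snd s 5 (int (y i))) \<and>
      (\<forall>i\<le>u. peak (insert x S) (- int (J (y i))) (snd s' 5 (int (y i)) - int (J (y i))))) s"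
proof -
  define Inv where "Inv = (\<lambda>j s'. j \<le> u \<and> fst s' 4 = int j \<and>
      (\<forall>a. a \<noteq> 5 \<longrightarrow> snd s' a = snd s a) \<and> (\<forall>r. r < 8 \<and> r \<noteq> 4 \<longrightarrow> fst s' r = fst s r) \<and>
      (\<forall>i. (i < j \<or> u \<le> i) \<and> i < card I \<longrightarrow> snd s' 5 (int (y i)) = snd s 5 (int (y i))) \<and>
      (\<forall>i. j \<le> i \<and> i < u \<longrightarrow>
        peak (insert x S) (- int (J (y i))) (snd s' 5 (int (y i)) - int (J (y i)))))"
  let ?B = "Seq (Assign 4 (Bin Sub (Reg 4) (Const 1)))
    (Seq (Assign 8 (task (Reg 4)))
    (Seq (Assign 9 (Bin Quot (Bin Sub (jitter_of (Reg 8)) (jitter_of (Reg 5))) (period_of (Reg 5))))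
    (Seq (Assign 10 (Bin Add (peak_of (Reg 8)) (Bin Mul (cost_of (Reg 5)) (Reg 9))))
    (Seq (Assign 11 (Bin Sub
            (Bin Add (peak_of (Reg 5)) (Bin Sub (jitter_of (Reg 8)) (jitter_of (Reg 5))))
            (Bin Mul (Bin Add (Reg 9) (Const 1)) (Reg 6))))
      (If (Bin Sub (Reg 11) (Reg 10))
        (Store 5 (Reg 8) (Reg 11))
        (Store 5 (Reg 8) (Reg 10)))))))"
  have inj: "inj_on y {..<card I}" by (rule lists_tasks_inj[OF y])
  have yI: "y i \<in> I" if "i < card I" for i using lists_tasks_mem[OF y that] .
  have xS: "insert x S \<subseteq> I" "x \<notin> S"
    using yI u(2) x(1) by (auto simp: S(1) dest: inj_onD[OF inj])
  have step: "wp ?B (\<lambda>k s''. k \<le> 11 \<and> Inv j s'') s'" if inv: "Inv (Suc j) s'" for j s'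
  proof -
    define z where "z = y j"
    define N where "N = jobs x (- int (J z))"
    have j: "j < u" "j < card I" "fst s' 4 = 1 + int j"
      and frame: "\<And>a. a \<noteq> 5 \<Longrightarrow> snd s' a = snd s a" "\<And>r. r < 8 \<Longrightarrow> r \<noteq> 4 \<Longrightarrow> fst s' r = fst s r"
      and old: "\<And>i. i < Suc j \<or> u \<le> i \<Longrightarrow> i < card I \<Longrightarrow> snd s' 5 (int (y i)) = snd s 5 (int (y i))"
      and new: "\<And>i. Suc j \<le> i \<Longrightarrow> i < u \<Longrightarrow>
        peak (insert x S) (- int (J (y i))) (snd s' 5 (int (y i)) - int (J (y i)))"
      using inv u(2) by (auto simp: Inv_def)
    have zI: "z \<in> I" and xI: "x \<in> I" using yI[OF j(2)] xS(1) by (auto simp: z_def)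
    have cells: "snd s 4 (int j) = int z" "snd s' 5 (int z) = snd s 5 (int z)"
        "snd s' 5 (int x) = snd s 5 (int x)"
      using y j(2) old[of j] old[of u] u(2) x(1) by (auto simp: lists_tasks_def z_def)
    have vals: "snd s 0 (int x) = int (c x)" "snd s 2 (int x) = int (p x)" "snd s 3 (int x) = int (J x)"
        "snd s 3 (int z) = int (J z)"
      using par zI xI by (auto simp: holds_params_def)
    \<comment> \<open>At time \<open>- J z\<close> the negated numerator in \<open>jobs\<close> is
      \<open>J z - J x\<close>, the dividend in the program.\<close>
    have N: "(int (J z) - int (J x)) div int (p x) = - N"
      by (simp add: N_def jobs_def)
    define v where "v = snd s 5 (int z) + (- (int (c x) * N))"
    define w where "w = snd s 5 (int x) + (int (J z) - int (J x)) -
        (1 - N) * gain (insert x S) (int (p x))"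
    have "peak (insert x S) (- int (J z)) (max (snd s 5 (int z) - int (J z) - int (c x) * N)
        (snd s 5 (int x) - int (J x) + (N - 1) * gain (insert x S) (int (p x))))"
      unfolding N_def
      using pk[of j] pk[of u] j(1) x(1) by (intro peak_insert[OF xS S(2)]) (auto simp: z_def)
    also have "max (snd s 5 (int z) - int (J z) - int (c x) * N)
        (snd s 5 (int x) - int (J x) + (N - 1) * gain (insert x S) (int (p x))) = max v w - int (J z)"
      by (simp add: v_def w_def max_def algebra_simps)
    finally have mx: "peak (insert x S) (- int (J z)) (max v w - int (J z))" .
    have fin: "Inv j (r, (snd s')(5 := (snd s' 5)(int z := max v w)))"
      if "r 4 = int j" "\<And>q. q < 8 \<Longrightarrow> q \<noteq> 4 \<Longrightarrow> r q = fst s' q" for r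
    proof -
      have "y i \<noteq> z" if "i < card I" "i \<noteq> j" for i
        using that inj j(2) by (auto simp: z_def inj_on_def)
      moreover have "y j = z" by (simp add: z_def)
      moreover have "peak (insert x S) (- int (J (y i))) (((snd s' 5)(int z := max v w)) (int (y i)) - int (J (y i)))"
        if "j \<le> i" "i < u" for i
        using that new[of i] mx by (cases "i = j"; cases "y i = z") (auto simp: z_def)
      ultimately show ?thesis
        using that j frame old by (auto simp: Inv_def)
    qed
    have regs: "fst s' 5 = int x" "fst s' 6 = gain (insert x S) (int (p x))"
      using frame(2)[of 5] frame(2)[of 6] x by auto
    have arrs: "snd s' 0 = snd s 0" "snd s' 2 = snd s 2" "snd s' 3 = snd s 3" "snd s' 4 = snd s 4"
      using frame(1) by auto
    have "max v w = (if v < w then w else v)" by (simp add: max_def)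
    then show ?thesis
      using fin[of "(fst s')(4 := int j, 8 := int z, 9 := - N, 10 := v, 11 := w)"]
      by (simp add: j arrs regs cells vals N v_def w_def split: if_splits)
  qed
  have "Inv u ((fst s)(4 := int u), snd s)"
    using assms by (auto simp: Inv_def)
  then have "wp (While (Reg 4) ?B) (\<lambda>k s'. k \<le> u * (11 + 1) \<and> Inv 0 s') ((fst s)(4 := int u), snd s)"
    by (rule wp_countdown[where Inv = Inv, OF step, rotated 2]) (auto simp: Inv_def)
  \<comment> \<open>Position \<open>u\<close> is not visited by the loop: the old entry of
    \<open>x\<close> is already its new one.\<close>
  moreover have "peak (insert x S) (- int (J x)) (snd s 5 (int x) - int (J x))"
    using pk[of u] x(1) by (intro peak_insert_self[OF xS S(2)]) auto
  ultimately show ?thesis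
    unfolding update_peaks_def using u x(1)
    by (auto simp: Inv_def le_eq_less_or_eq elim!: wp_mono)
qed

text \<open>Positions below \<open>u\<close> are pending, the others added. Pending tasks carry
  peaks of the whole added set, while an added task keeps the peak and gain of the set at the moment
  it joined, which is what the descent reads. Register 7 lies between the two groups in the
  divisibility order.\<close>

definition ascent_inv :: "(nat \<Rightarrow> nat) \<Rightarrow> nat \<Rightarrow> state \<Rightarrow> bool" where
  "ascent_inv y u s \<longleftrightarrow> u \<le> card I \<and> fst s 1 = int u \<and> fst s 3 = int (card I - u) \<and>
    holds_params (snd s) \<and> lists_tasks y (snd s) \<and>
    0 < fst s 7 \<and> fst s 6 = gain (y ` {u..<card I}) (fst s 7) \<and>
    (\<forall>x\<in>y ` {u..<card I}. int (p x) dvd fst s 7) \<and>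
    (\<forall>x\<in>y ` {..<u}. fst s 7 dvd int (p x) \<and>
      peak (y ` {u..<card I}) (- int (J x)) (snd s 5 (int x) - int (J x))) \<and>
    (\<forall>i\<in>{u..<card I}. (\<forall>x\<in>y ` {i..<card I}. int (p x) dvd int (p (y i))) \<and>
      snd s 6 (int (y i)) = gain (y ` {i..<card I}) (int (p (y i))) \<and>
      peak (y ` {i..<card I}) (- int (J (y i))) (snd s 5 (int (y i)) - int (J (y i))))"

lemma ascent_inv_high:
  assumes "ascent_inv y u s" "u \<le> i" "i < card I"
  shows "\<forall>x\<in>y ` {i..<card I}. int (p x) dvd int (p (y i))"
    and "snd s 6 (int (y i)) = gain (y ` {i..<card I}) (int (p (y i)))"
    and "peak (y ` {i..<card I}) (- int (J (y i))) (snd s 5 (int (y i)) - int (J (y i)))"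
  using assms by (simp_all add: ascent_inv_def)

text \<open>The task moved to the boundary has the least pending period; by harmonicity this period
  divides all other pending ones and can become the new value of register 7.\<close>

lemma ascend:
  assumes inv: "ascent_inv y (Suc u) s"
  shows "wp ascend (\<lambda>k s'. k \<le> 15 * card I \<and> fst s' 2 = fst s 2 \<and> (\<exists>y'. ascent_inv y' u s')) s"
proof -
  define S where "S = y ` {Suc u..<card I}"
  define L where "L = fst s 7"
  have u: "u < card I" and reg: "fst s 1 = 1 + int u" "fst s 3 = int (card I - Suc u)"
    and par: "holds_params (snd s)" and y: "lists_tasks y (snd s)"
    and L: "0 < L" "fst s 6 = gain S L" "\<And>x. x \<in> S \<Longrightarrow> int (p x) dvd L"
    and low: "\<And>x. x \<in> y ` {..u} \<Longrightarrow> L dvd int (p x) \<and>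
      peak S (- int (J x)) (snd s 5 (int x) - int (J x))"
    and high: "\<And>i. u < i \<Longrightarrow> i < card I \<Longrightarrow> (\<forall>x\<in>y ` {i..<card I}. int (p x) dvd int (p (y i))) \<and>
      snd s 6 (int (y i)) = gain (y ` {i..<card I}) (int (p (y i))) \<and>
      peak (y ` {i..<card I}) (- int (J (y i))) (snd s 5 (int (y i)) - int (J (y i)))"
    using inv by (auto simp: ascent_inv_def S_def L_def lessThan_Suc_atMost)
  \<comment> \<open>The state after selection and the assignments following it; the 5 counts the
    operations of \<open>ascend\<close> outside its two loops.\<close>
  have goal: "wp update_peaks (\<lambda>k2 s2. k1 + k2 + 5 \<le> 15 * card I \<and>
        fst s2 2 = fst s 2 \<and> (\<exists>y'. ascent_inv y' u ((fst s2)(3 := fst s2 3 + 1), snd s2)))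
      ((fst s1)(5 := int x, 6 := fst s1 6 * (snd s1 2 (int x) div fst s1 7) - snd s1 0 (int x),
          7 := snd s1 2 (int x)),
        (snd s1)(6 := (snd s1 6)(int x := fst s1 6 * (snd s1 2 (int x) div fst s1 7) - snd s1 0 (int x))))"
    if k1: "k1 \<le> 3 * u"
      and frame: "\<And>a. a \<noteq> 4 \<Longrightarrow> snd s1 a = snd s a"
        "\<And>r. r \<noteq> 4 \<Longrightarrow> r \<noteq> 5 \<Longrightarrow> fst s1 r = (if r = 1 then int u else fst s r)"
      and y': "lists_tasks y' (snd s1)" "y' ` {..u} = y ` {..u}" "\<And>i. u < i \<Longrightarrow> y' i = y i"
        "\<And>i. i \<le> u \<Longrightarrow> p (y' u) \<le> p (y' i)"
      and x: "x = y' u"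
    for k1 s1 y' x
  proof -
    have img: "y' ` {i..<card I} = y ` {i..<card I}" if "u < i" for i
      using that y'(3) by (intro image_cong) auto
    then have S: "S = y' ` {Suc u..<card I}" by (simp add: S_def)
    have Sx: "y' ` {u..<card I} = insert x S"
      using u unfolding S x by (simp add: atLeastLessThan_eq_insert)
    have memI: "y' i \<in> I" if "i < card I" for i using lists_tasks_mem[OF y'(1) that] .
    have xI: "x \<in> I" using memI[OF u] x by simp
    have sub: "insert x S \<subseteq> I" using memI xI by (auto simp: S)
    have xS: "x \<notin> S"
      using u by (auto simp: S x dest: inj_onD[OF lists_tasks_inj[OF y'(1)]])
    have Lx: "L dvd int (p x)"
      using low[of x] y'(2) x by auto
    have dvdS: "\<And>i. i \<in> S \<Longrightarrow> int (p i) dvd int (p x)"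
      using L(3) Lx dvd_trans by blast
    have vals: "snd s 2 (int x) = int (p x)" "snd s 0 (int x) = int (c x)"
      using par xI by (auto simp: holds_params_def)
    have "gain S (int (p x)) = gain S L * (int (p x) div L)"
      using gain_mult[of S L "int (p x) div L"] L(3) Lx by simp
    then have gx: "gain S L * (int (p x) div L) - int (c x) = gain (insert x S) (int (p x))"
      using gain_insert[OF sub xS] by simp
    define s2 where "s2 = ((fst s1)(5 := int x, 6 := gain (insert x S) (int (p x)), 7 := int (p x)),
        (snd s1)(6 := (snd s1 6)(int x := gain (insert x S) (int (p x)))))"
    have s2: "fst s2 1 = int u" "fst s2 2 = fst s 2" "fst s2 3 = int (card I - Suc u)"
        "fst s2 5 = int x" "fst s2 6 = gain (insert x S) (int (p x))" "fst s2 7 = int (p x)"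
        "snd s2 5 = snd s 5" "snd s2 6 = (snd s 6)(int x := gain (insert x S) (int (p x)))"
      using frame reg by (simp_all add: s2_def)
    have par2: "holds_params (snd s2)" and y2: "lists_tasks y' (snd s2)"
      using par y'(1) frame(1) by (auto simp: s2_def holds_params_def lists_tasks_def)
    have pk: "peak S (- int (J (y' i))) (snd s2 5 (int (y' i)) - int (J (y' i)))" if "i \<le> u" for i
      using low[of "y' i"] y'(2) that s2(7) by auto
    \<comment> \<open>The strict inequality \<open>u < card I\<close> leaves 15 spare operations,
      enough for the 5 outside the loops.\<close>
    have fin: "12 * u + k1 + 5 \<le> 15 * card I"
      using k1 u by linarith
    have "ascent_inv y' u ((fst s3)(3 := fst s3 3 + 1), snd s3)"
      if fr: "\<forall>a. a \<noteq> 5 \<longrightarrow> snd s3 a = snd s2 a" "\<forall>r. r < 8 \<and> r \<noteq> 4 \<longrightarrow> fst s3 r = fst s2 r"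
        and old: "\<forall>i. u < i \<and> i < card I \<longrightarrow> snd s3 5 (int (y' i)) = snd s2 5 (int (y' i))"
        and new: "\<forall>i\<le>u. peak (insert x S) (- int (J (y' i))) (snd s3 5 (int (y' i)) - int (J (y' i)))"
      for s3
    proof -
      have regs: "fst s3 1 = int u" "fst s3 3 = int (card I - Suc u)"
          "fst s3 6 = gain (insert x S) (int (p x))" "fst s3 7 = int (p x)"
        using fr(2) s2 by simp_all
      have A: "holds_params (snd s3)" "lists_tasks y' (snd s3)"
        using par2 y2 fr(1) by (auto simp: holds_params_def lists_tasks_def)
      have B: "int (p x) dvd int (p z) \<and> peak (insert x S) (- int (J z)) (snd s3 5 (int z) - int (J z))"
        if z: "z \<in> y' ` {..<u}" for z
      proof -
        obtain i where i: "i < u" "z = y' i" using z by auto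
        then have "p x dvd p z"
          using y'(4)[of i] memI[of i] xI u by (intro p_dvd) (auto simp: x)
        then show ?thesis using new i by auto
      qed
      have C: "(\<forall>z\<in>y' ` {i..<card I}. int (p z) dvd int (p (y' i))) \<and>
          snd s3 6 (int (y' i)) = gain (y' ` {i..<card I}) (int (p (y' i))) \<and>
          peak (y' ` {i..<card I}) (- int (J (y' i))) (snd s3 5 (int (y' i)) - int (J (y' i)))"
        if i: "u \<le> i" "i < card I" for i
      proof (cases "i = u")
        case True
        then show ?thesis
          using dvdS new fr(1) s2(8) Sx by (auto simp: x)
      next
        case False
        then have ui: "u < i" using i(1) by simp
        have "y' i \<in> S" using ui i(2) by (auto simp: S)
        then have "y' i \<noteq> x" using xS by auto
        then show ?thesis
          using high[OF ui i(2)] old ui i(2) fr(1) s2(7,8) y'(3)[OF ui] img[OF ui] by auto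
      qed
      show ?thesis
        unfolding ascent_inv_def Sx using A B C u regs dvdS p_pos[OF xI] by (auto simp: Sx)
    qed
    then have "wp update_peaks (\<lambda>k2 s3. k1 + k2 + 5 \<le> 15 * card I \<and>
        fst s3 2 = fst s 2 \<and> (\<exists>y'. ascent_inv y' u ((fst s3)(3 := fst s3 3 + 1), snd s3))) s2"
      using s2(2) fin
      by (intro wp_mono[OF update_peaks[OF s2(1) u par2 y2 x[symmetric] s2(4,5) S dvdS pk]]) auto
    moreover have "fst s1 6 * (snd s1 2 (int x) div fst s1 7) - snd s1 0 (int x) = gain (insert x S) (int (p x))"
        "snd s1 2 (int x) = int (p x)"
      using frame vals L(2) gx by (simp_all add: L_def)
    ultimately show ?thesis by (simp add: s2_def)
  qed
  have sel: "wp select_min (\<lambda>k s'. k \<le> 3 * u \<and>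
      (\<forall>a. a \<noteq> 4 \<longrightarrow> snd s' a = snd s a) \<and>
      (\<forall>r. r \<noteq> 4 \<and> r \<noteq> 5 \<longrightarrow> fst s' r = (if r = 1 then int u else fst s r)) \<and>
      (\<exists>y'. lists_tasks y' (snd s') \<and> y' ` {..u} = y ` {..u} \<and> (\<forall>i>u. y' i = y i) \<and>
        (\<forall>i\<le>u. p (y' u) \<le> p (y' i)))) ((fst s)(1 := int u), snd s)"
    using select_min[of "((fst s)(1 := int u), snd s)" u y] u par y
    by (auto elim!: wp_mono)
  show ?thesis
    unfolding ascend_def
    apply (simp add: reg(1) del: One_nat_def)
    apply (rule wp_mono[OF sel])
    apply (elim conjE exE)
    subgoal premises prems for k1 s1 y'
    proof -
      have cell: "fst s1 1 = int u" "snd s1 4 (int u) = int (y' u)"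
        using prems u by (auto simp: lists_tasks_def)
      show ?thesis
        using goal[of k1 s1 y' "y' u"] prems by (simp add: cell del: One_nat_def) (erule wp_mono, simp add: add_ac)
    qed
    done
qed

text \<open>The tasks still present are those that had been added when the current one joined, so
  its table entries describe exactly this set. Arrays stay fixed; only the demand changes.\<close>

lemma descend:
  assumes inv: "ascent_inv y 0 (r0, h)"
    and j: "Suc j \<le> card I" "fst s 1 = int (card I - Suc j)" "fst s 3 = int (Suc j)" "snd s = h"
    and t: "first_time (y ` {card I - Suc j..<card I}) (fst s 2) t"
  shows "wp descend (\<lambda>k s'. k \<le> 7 \<and> fst s' 1 = int (card I - j) \<and> fst s' 3 = int j \<and> snd s' = h \<and>
      first_time (y ` {card I - j..<card I}) (fst s' 2) t) s"
proof -
  define i where "i = card I - Suc j"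
  define S where "S = y ` {Suc i..<card I}"
  define x where "x = y i"
  have i: "i < card I" "card I - j = Suc i" "fst s 1 = int i" using j(1,2) by (auto simp: i_def)
  have par: "holds_params h" and y: "lists_tasks y h"
    using inv by (auto simp: ascent_inv_def)
  have xI: "x \<in> I" using lists_tasks_mem[OF y i(1)] by (simp add: x_def)
  have Sx: "y ` {i..<card I} = insert x S"
    using i(1) unfolding S_def x_def by (simp add: atLeastLessThan_eq_insert)
  have sub: "insert x S \<subseteq> I" using lists_tasks_mem[OF y] xI by (auto simp: S_def)
  have xS: "x \<notin> S"
    using i(1) by (auto simp: S_def x_def dest: inj_onD[OF lists_tasks_inj[OF y]])
  have tab: "\<forall>z\<in>insert x S. int (p z) dvd int (p x)" "h 6 (int x) = gain (insert x S) (int (p x))"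
      "peak (insert x S) (- int (J x)) (h 5 (int x) - int (J x))"
    using ascent_inv_high[OF inv, of i] i(1) by (simp_all add: Sx flip: x_def)
  have vals: "h 4 (int i) = int x" "h 0 (int x) = int (c x)" "h 3 (int x) = int (J x)"
    using par y i(1) xI by (auto simp: holds_params_def lists_tasks_def x_def)
  have "first_time S (fst s 2 + int (c x) *
      - ((h 5 (int x) - int (J x) - fst s 2) div gain (insert x S) (int (p x)))) t"
    using t tab Sx by (intro first_time_insert[OF sub xS]) (auto simp: i_def[symmetric])
  then show ?thesis
    using i j(3,4) vals tab(2) by (simp add: descend_def S_def)
qed

text \<open>Once all tasks have been dropped the surplus is time itself, so the demand left over is
  the first time sought.\<close>

lemma response_program:
  assumes par: "holds_params (snd s)" and y: "lists_tasks y (snd s)"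
    and s: "fst s 1 = int (card I)" "fst s 3 = 0" "snd s 5 = (\<lambda>_. 0)"
    and t: "first_time I (fst s 2) t"
  shows "wp response_program (\<lambda>k s'. k \<le> 29 * card I ^ 2 \<and> fst s' 0 = t) s"
proof -
  define a where "a = fst s 2"
  \<comment> \<open>With no task added, period 1 and gain 1 are correct, and the zeros in array 5
    encode the peak \<open>- J x\<close> at time \<open>- J x\<close>.\<close>
  have "ascent_inv y (card I) ((fst s)(6 := 1, 7 := 1), snd s)"
    using par y s peak_empty by (auto simp: ascent_inv_def gain_def)
  then have "fst ((fst s)(6 := 1, 7 := 1), snd s) 2 = a \<and>
      (\<exists>y. ascent_inv y (card I) ((fst s)(6 := 1, 7 := 1), snd s))"
    by (auto simp: a_def)
  then have up: "wp (While (Reg 1) ascend)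
      (\<lambda>k s'. k \<le> card I * (15 * card I + 1) \<and> fst s' 2 = a \<and> (\<exists>y. ascent_inv y 0 s'))
      ((fst s)(6 := 1, 7 := 1), snd s)"
  proof (intro wp_countdown[where Inv = "\<lambda>j s'. fst s' 2 = a \<and> (\<exists>y. ascent_inv y j s')"])
    fix j s' assume "fst s' 2 = a \<and> (\<exists>y. ascent_inv y (Suc j) s')"
    then obtain y where "fst s' 2 = a" "ascent_inv y (Suc j) s'" by blast
    then show "wp ascend (\<lambda>k s''. k \<le> 15 * card I \<and> fst s'' 2 = a \<and> (\<exists>y. ascent_inv y j s'')) s'"
      using ascend[of y j s'] by simp
  qed (auto simp: ascent_inv_def)
  have down: "wp (While (Reg 3) descend) (\<lambda>k s''. k \<le> card I * (7 + 1) \<and> fst s'' 2 = t) s'"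
    if s': "fst s' 2 = a" "ascent_inv y' 0 s'" for s' y'
  proof -
    have inv: "ascent_inv y' 0 (fst s', snd s')" using s'(2) by simp
    then have "y' ` {0..<card I} = I"
      by (auto simp: ascent_inv_def lists_tasks_def atLeast0LessThan)
    then have "first_time (y' ` {card I - card I..<card I}) (fst s' 2) t"
      using t s'(1) by (simp add: a_def)
    then have "wp (While (Reg 3) descend) (\<lambda>k s''. k \<le> card I * (7 + 1) \<and>
        (0 \<le> card I \<and> fst s'' 1 = int (card I - 0) \<and> fst s'' 3 = int 0 \<and> snd s'' = snd s' \<and>
          first_time (y' ` {card I - 0..<card I}) (fst s'' 2) t)) s'"
      using inv
      by (intro wp_countdown[where Inv = "\<lambda>j s''. j \<le> card I \<and> fst s'' 1 = int (card I - j) \<and>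
          fst s'' 3 = int j \<and> snd s'' = snd s' \<and> first_time (y' ` {card I - j..<card I}) (fst s'' 2) t"])
        (auto simp: ascent_inv_def intro: wp_mono[OF descend[OF inv]])
    then show ?thesis
      by (rule wp_mono) (auto dest: first_time_empty)
  qed
  \<comment> \<open>With \<open>m = card I\<close> the two loops cost at most
    \<open>15 * m^2 + 9 * m\<close>, and \<open>m \<le> m^2\<close>. There is no additive constant,
    as the bound has to be 0 for the empty set.\<close>
  have cost: "k + k' \<le> 29 * card I ^ 2"
    if "k \<le> card I * (15 * card I + 1)" "k' \<le> card I * (7 + 1)" for k k'
  proof -
    have "card I \<le> card I ^ 2" by (simp add: power2_eq_square)
    moreover have "k \<le> 15 * card I ^ 2 + card I" "k' \<le> 8 * card I"
      using that by (simp_all add: power2_eq_square algebra_simps)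
    ultimately show ?thesis by linarith
  qed
  have rest: "wp (Seq (While (Reg 3) descend) (Assign 0 (Reg 2)))
      (\<lambda>k' s''. k + k' \<le> 29 * card I ^ 2 \<and> fst s'' 0 = t) s'"
    if k: "k \<le> card I * (15 * card I + 1)" and s': "fst s' 2 = a \<and> (\<exists>y. ascent_inv y 0 s')" for k s'
  proof -
    obtain y' where "fst s' 2 = a" "ascent_inv y' 0 s'" using s' by blast
    from down[OF this] show ?thesis
      unfolding wp_Seq by (rule wp_mono) (use cost[OF k] in auto)
  qed
  have "wp (Seq (While (Reg 1) ascend) (Seq (While (Reg 3) descend) (Assign 0 (Reg 2))))
      (\<lambda>k s'. k \<le> 29 * card I ^ 2 \<and> fst s' 0 = t) ((fst s)(6 := 1, 7 := 1), snd s)"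
    unfolding wp_Seq[of "While (Reg 1) ascend"] by (rule wp_mono[OF up]) (use rest in blast)
  then show ?thesis
    by (simp add: response_program_def del: One_nat_def)
qed

end

section \<open>Application to a harmonic task system\<close>

theorem theorem17:
  "\<exists>(P :: com) (C :: real).
    \<forall>(n :: nat) (c :: nat \<Rightarrow> nat) (d :: nat \<Rightarrow> nat) (p :: nat \<Rightarrow> nat) (J :: nat \<Rightarrow> nat)
      (I :: nat set) (\<gamma> :: nat) (xs :: nat list).
      harmonic_task_system n c d p J \<and> I \<subseteq> {1..n - 1} \<and> \<gamma> \<ge> 1 \<and>
      distinct xs \<and> set xs = I \<longrightarrow>
      (\<exists>k. computes_at_cost P (input_state n c d p J xs \<gamma>) (int (response_time c p J I \<gamma>)) k \<and>
        real k \<le> C * (real (card ((\<lambda>i. int (p i) - int (J i)) ` I)) * real (card I) ^ 2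
                      + real (card I) ^ 2 * log 2 (real (Max (p ` {1..n})))))"
proof (intro exI[of _ response_program] exI[of _ "29 :: real"] allI impI)
  fix n \<gamma> :: nat and c d p J I and xs :: "nat list"
  assume asm: "harmonic_task_system n c d p J \<and> I \<subseteq> {1..n - 1} \<and> \<gamma> \<ge> 1 \<and> distinct xs \<and> set xs = I"
  then have sys: "harmonic_task_system n c d p J" and I: "I \<subseteq> {1..n - 1}" "set xs = I"
    and xs: "distinct xs" and \<gamma>: "0 < \<gamma>" by auto
  have In: "I \<subseteq> {1..n}" "I \<subseteq> {1..<n}" using I(1) by fastforce+
  interpret harmonic_tasks c p J I
  proof
    show "finite I" using I(2) by auto
    show "0 < p i" if "i \<in> I" for i
      using sys that In(1) by (force simp: harmonic_task_system_def)
    show "p i dvd p j" if ij: "i \<in> I" "j \<in> I" and le: "p i \<le> p j" for i j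
    proof -
      have "0 < p i"
        using sys ij(1) In(1) by (force simp: harmonic_task_system_def)
      moreover have "real (p j) / real (p i) \<in> \<int>"
        using sys ij In(1) le by (auto simp: harmonic_task_system_def harmonic_def)
      then obtain q :: int where "real (p j) / real (p i) = of_int q"
        by (elim Ints_cases)
      ultimately have "real_of_int (int (p j)) = real_of_int (q * int (p i))"
        by (simp add: field_simps)
      then have "int (p i) dvd int (p j)"
        by (simp only: of_int_eq_iff) simp
      then show ?thesis by simp
    qed
    have "(\<Sum>i\<in>I. real (c i) / real (p i)) \<le> (\<Sum>i\<in>{1..<n}. real (c i) / real (p i))"
      using In(2) by (intro sum_mono2) auto
    then show "(\<Sum>i\<in>I. real (c i) / real (p i)) < 1"
      using sys by (simp add: harmonic_task_system_def)
  qed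
  define s where "s = input_state n c d p J xs \<gamma>"
  define q where "q = card ((\<lambda>i. int (p i) - int (J i)) ` I)"
  define l where "l = log 2 (real (Max (p ` {1..n})))"
  have len: "length xs = card I" using distinct_card[OF xs] I(2) by simp
  have par: "holds_params (snd s)"
    using In(1) by (fastforce simp: holds_params_def s_def input_state_def)
  \<comment> \<open>The initial ordering is the input list itself.\<close>
  have tasks: "lists_tasks ((!) xs) (snd s)"
    using I(2) len by (auto simp: lists_tasks_def s_def input_state_def in_set_conv_nth image_iff)
  have first: "first_time I (fst s 2) (int (response_time c p J I \<gamma>))"
    using first_time_response[OF response_bound_exists[OF sys I(1)] \<gamma>]
    by (simp add: s_def input_state_def)
  have "wp response_program
      (\<lambda>k s'. k \<le> 29 * card I ^ 2 \<and> fst s' 0 = int (response_time c p J I \<gamma>)) s"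
    by (rule response_program[OF par tasks _ _ _ first]) (auto simp: s_def input_state_def len)
  then obtain k where k: "computes_at_cost response_program s (int (response_time c p J I \<gamma>)) k"
      "k \<le> 29 * card I ^ 2"
    unfolding wp_def computes_at_cost_def by blast
  have "p 1 \<in> p ` {1..n}" "1 \<le> p 1"
    using sys by (auto simp: harmonic_task_system_def)
  then have "1 \<le> Max (p ` {1..n})"
    by (meson Max_ge finite_atLeastAtMost finite_imageI order_trans)
  then have l: "0 \<le> l" by (simp add: l_def)
  \<comment> \<open>Both sides are 0 for empty \<open>I\<close>; otherwise the image counted by
    \<open>q\<close> is nonempty.\<close>
  have "card I ^ 2 \<le> q * card I ^ 2"
    using fin by (cases "I = {}") (auto simp: q_def card_gt_0_iff Suc_le_eq)
  then have "real (card I ^ 2) \<le> real (q * card I ^ 2)"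
    by (simp only: of_nat_le_iff)
  moreover have "real k \<le> 29 * real (card I ^ 2)"
    using k(2) by (metis of_nat_le_iff of_nat_mult of_nat_numeral)
  ultimately have "real k \<le> 29 * (real q * real (card I) ^ 2 + real (card I) ^ 2 * l)"
    using mult_nonneg_nonneg[OF zero_le_power[of "real (card I)" 2] l] by simp
  then show "\<exists>k. computes_at_cost response_program (input_state n c d p J xs \<gamma>)
        (int (response_time c p J I \<gamma>)) k \<and>
      real k \<le> 29 * (real (card ((\<lambda>i. int (p i) - int (J i)) ` I)) * real (card I) ^ 2
        + real (card I) ^ 2 * log 2 (real (Max (p ` {1..n}))))"
    using k(1) by (auto simp: s_def q_def l_def)
qed

end
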